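(* Let $f\in L([a,b];H)$, let $e\in H$ with $\|e\|=1$, and let $k:[a,b]\to[0,\infty)$ be a Lebesgue integrable function such that $$\|f(t)\|-\operatorname{Re}\langle f(t),e\rangle\le k(t)\quad\text{for a.e. }t\in[a,b].$$ Then $$(0\le)\ \int_a^b\|f(t)\|\,dt-\left\|\int_a^b f(t)\,dt\right\|\le\int_a^b k(t)\,dt .$$ Equality holds in the last inequality (the upper bound) if and only if both $$\int_a^b\|f(t)\|\,dt\ge\int_a^b k(t)\,dt$$ and $$\int_a^b f(t)\,dt=\left(\int_a^b\|f(t)\|\,dt-\int_a^b k(t)\,dt\right)e .$$
   Context: $[a,b]$ is a compact real interval with $a<b$; $(H;\langle\cdot,\cdot\rangle)$ is a Hilbert space over $\mathbb{K}=\mathbb{R}$ or $\mathbb{C}$ with norm $\|\cdot\|$. $L([a,b];H)$ denotes the space of Bochner integrable functions on $[a,b]$ (with Lebesgue measure) with values in $H$; integrals of $H$-valued functions are Bochner integrals. *)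

theory Defs
  imports "HOL-Analysis.Analysis"
begin

section \<open>The scalar fields \<open>\<real>\<close> and \<open>\<complex>\<close>\<close>

text \<open>
  A type of this class is a copy of \<open>\<real>\<close> or of \<open>\<complex>\<close>: \<open>to_complex\<close> is an isometric embedding of
  real algebras whose image is one of the two. The canonical instances are \<^typ>\<open>real\<close>
  and \<^typ>\<open>complex\<close>.
\<close>

class real_or_complex = real_normed_field +
  fixes to_complex :: "'a \<Rightarrow> complex"
  assumes to_complex_add: "to_complex (x + y) = to_complex x + to_complex y"
    and to_complex_mult: "to_complex (x * y) = to_complex x * to_complex y"
    and to_complex_scaleR: "to_complex (r *\<^sub>R x) = r *\<^sub>R to_complex x"
    and norm_to_complex: "norm (to_complex x) = norm x"
    and range_to_complex: "range to_complex = \<real> \<or> range to_complex = UNIV"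

instantiation real :: real_or_complex
begin

definition to_complex_real :: "real \<Rightarrow> complex" where
  "to_complex_real = complex_of_real"

instance
  by standard (auto simp: to_complex_real_def Reals_def scaleR_conv_of_real)

end

instantiation complex :: real_or_complex
begin

definition to_complex_complex :: "complex \<Rightarrow> complex" where
  "to_complex_complex = id"

instance
  by standard (auto simp: to_complex_complex_def)

end


section \<open>Hilbert spaces\<close>

text \<open>
  The vector space structure over \<open>'k\<close> and the inner product (linear in the first argument) are
  explicit, while topology, norm and completeness come from the underlying real Banach space
  \<open>'h\<close>. No separability is assumed.
\<close>

locale hilbert_space = vector_space scale
  for scale :: "'k::real_or_complex \<Rightarrow> 'h::banach \<Rightarrow> 'h" +
  fixes ip :: "'h \<Rightarrow> 'h \<Rightarrow> 'k"
  assumes scale_of_real: "scale (of_real r) x = r *\<^sub>R x"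
    and ip_add_left: "ip (x + y) z = ip x z + ip y z"
    and ip_scale_left: "ip (scale c x) y = c * ip x y"
    and ip_commute: "to_complex (ip y x) = cnj (to_complex (ip x y))"
    and ip_self: "ip x x = of_real ((norm x)\<^sup>2)"

lemma hilbert_space_real_inner:
  "hilbert_space (scaleR :: real \<Rightarrow> 'h \<Rightarrow> 'h) (inner :: 'h::{real_inner, banach} \<Rightarrow> 'h \<Rightarrow> real)"
  by unfold_locales
    (auto simp: algebra_simps inner_left_distrib to_complex_real_def inner_commute
      power2_norm_eq_inner)

lemma hilbert_space_complex:
  "hilbert_space (*) (\<lambda>x y. x * cnj y)"
  by unfold_locales
    (auto simp: algebra_simps to_complex_complex_def scaleR_conv_of_real complex_norm_square
      simp del: of_real_power)


section \<open>The Bochner integral without separability\<close>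

text \<open>
  The library's \<^const>\<open>has_bochner_integral\<close> is restricted to second countable, hence separable,
  target spaces. The following is the usual definition for arbitrary normed spaces; the
  requirement that \<open>f\<close> is an almost everywhere limit of simple functions (strong measurability)
  is explicit here. For second countable targets the two notions agree, as shown below.
\<close>

definition has_strong_bochner_integral ::
  "'a measure \<Rightarrow> ('a \<Rightarrow> 'b::real_normed_vector) \<Rightarrow> 'b \<Rightarrow> bool" where
  "has_strong_bochner_integral M f I \<longleftrightarrow>
     f \<in> borel_measurable M \<and>
     (\<exists>s. (\<forall>i. Bochner_Integration.simple_bochner_integrable M (s i)) \<and>
          (AE x in M. (\<lambda>i. s i x) \<longlonglongrightarrow> f x) \<and>
          (\<lambda>i. \<integral>\<^sup>+x. norm (f x - s i x) \<partial>M) \<longlonglongrightarrow> 0 \<and>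
          (\<lambda>i. Bochner_Integration.simple_bochner_integral M (s i)) \<longlonglongrightarrow> I)"

definition strong_bochner_integrable ::
  "'a measure \<Rightarrow> ('a \<Rightarrow> 'b::real_normed_vector) \<Rightarrow> bool" where
  "strong_bochner_integrable M f \<longleftrightarrow> (\<exists>I. has_strong_bochner_integral M f I)"

definition strong_bochner_integral ::
  "'a measure \<Rightarrow> ('a \<Rightarrow> 'b::real_normed_vector) \<Rightarrow> 'b" where
  "strong_bochner_integral M f =
     (if strong_bochner_integrable M f then THE I. has_strong_bochner_integral M f I else 0)"

lemma borel_measurable_norm_diff_simple:
  fixes f :: "'a \<Rightarrow> 'b::real_normed_vector"
  assumes f: "f \<in> borel_measurable M" and s: "simple_function M s"
  shows "(\<lambda>x. norm (f x - s x)) \<in> borel_measurable M"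
proof (rule measurable_compose_countable'[where f = "\<lambda>y x. norm (f x - y)" and I = "s ` space M"])
  show "(\<lambda>x. norm (f x - y)) \<in> borel_measurable M" for y
    by (rule measurable_compose[OF f])
      (intro borel_measurable_continuous_onI continuous_intros)
  show "s \<in> measurable M (count_space (s ` space M))"
    using s by (auto simp: measurable_count_space_eq2 simple_function_def)
  show "countable (s ` space M)"
    using s by (simp add: simple_function_def countable_finite)
qed

lemma has_strong_bochner_integral_unique:
  assumes "has_strong_bochner_integral M f I" "has_strong_bochner_integral M f J"
  shows "I = J"
proof -
  have f: "f \<in> borel_measurable M"
    using assms(1) by (simp add: has_strong_bochner_integral_def)
  obtain s where s: "\<And>i. Bochner_Integration.simple_bochner_integrable M (s i)"
    and s0: "(\<lambda>i. \<integral>\<^sup>+x. norm (f x - s i x) \<partial>M) \<longlonglongrightarrow> 0"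
    and sI: "(\<lambda>i. Bochner_Integration.simple_bochner_integral M (s i)) \<longlonglongrightarrow> I"
    using assms(1) unfolding has_strong_bochner_integral_def by blast
  obtain t where t: "\<And>i. Bochner_Integration.simple_bochner_integrable M (t i)"
    and t0: "(\<lambda>i. \<integral>\<^sup>+x. norm (f x - t i x) \<partial>M) \<longlonglongrightarrow> 0"
    and tJ: "(\<lambda>i. Bochner_Integration.simple_bochner_integral M (t i)) \<longlonglongrightarrow> J"
    using assms(2) unfolding has_strong_bochner_integral_def by blast
  have bound: "ennreal (norm (Bochner_Integration.simple_bochner_integral M (s i) - Bochner_Integration.simple_bochner_integral M (t i)))
      \<le> (\<integral>\<^sup>+x. norm (f x - s i x) \<partial>M) + (\<integral>\<^sup>+x. norm (f x - t i x) \<partial>M)" for i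
  proof -
    have "norm (Bochner_Integration.simple_bochner_integral M (s i) - Bochner_Integration.simple_bochner_integral M (t i))
        = norm (Bochner_Integration.simple_bochner_integral M (\<lambda>x. s i x - t i x))"
      using s t by (subst simple_bochner_integral_diff) auto
    also have "\<dots> \<le> Bochner_Integration.simple_bochner_integral M (\<lambda>x. norm (s i x - t i x))"
      using simple_bochner_integrable_compose2[of "(-)" M "s i" "t i"] s t
      by (auto intro!: simple_bochner_integral_norm_bound)
    finally have "ennreal (norm (Bochner_Integration.simple_bochner_integral M (s i) - Bochner_Integration.simple_bochner_integral M (t i)))
        \<le> ennreal (Bochner_Integration.simple_bochner_integral M (\<lambda>x. norm (s i x - t i x)))"
      by (rule ennreal_leI)
    also have "\<dots> = (\<integral>\<^sup>+x. norm (s i x - t i x) \<partial>M)"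
      using simple_bochner_integrable_compose2[of "\<lambda>x y. norm (x - y)" M "s i" "t i"] s t
      by (auto intro!: simple_bochner_integral_eq_nn_integral)
    also have "\<dots> \<le> (\<integral>\<^sup>+x. ennreal (norm (f x - s i x)) + ennreal (norm (f x - t i x)) \<partial>M)"
    proof (rule nn_integral_mono)
      fix x
      have "norm (s i x - t i x) \<le> norm (f x - s i x) + norm (f x - t i x)"
        by (metis dual_order.refl norm_diff_triangle_le norm_minus_commute)
      then show "ennreal (norm (s i x - t i x))
          \<le> ennreal (norm (f x - s i x)) + ennreal (norm (f x - t i x))"
        by (simp flip: ennreal_plus)
    qed
    also have "\<dots> = (\<integral>\<^sup>+x. norm (f x - s i x) \<partial>M) + (\<integral>\<^sup>+x. norm (f x - t i x) \<partial>M)"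
      using borel_measurable_norm_diff_simple[OF f, of "s i"]
        borel_measurable_norm_diff_simple[OF f, of "t i"] s[of i] t[of i]
      by (intro nn_integral_add) (auto simp: simple_bochner_integrable.simps)
    finally show ?thesis .
  qed
  have "(\<lambda>i. ennreal (norm (Bochner_Integration.simple_bochner_integral M (s i) - Bochner_Integration.simple_bochner_integral M (t i))))
      \<longlonglongrightarrow> ennreal 0"
  proof (rule tendsto_sandwich)
    show "eventually (\<lambda>i. 0 \<le> ennreal (norm (Bochner_Integration.simple_bochner_integral M (s i)
        - Bochner_Integration.simple_bochner_integral M (t i)))) sequentially"
      "(\<lambda>_. 0) \<longlonglongrightarrow> ennreal 0"
      by auto
    show "eventually (\<lambda>i. ennreal (norm (Bochner_Integration.simple_bochner_integral M (s i)
        - Bochner_Integration.simple_bochner_integral M (t i)))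
        \<le> (\<integral>\<^sup>+x. norm (f x - s i x) \<partial>M) + (\<integral>\<^sup>+x. norm (f x - t i x) \<partial>M)) sequentially"
      by (intro always_eventually allI bound)
    show "(\<lambda>i. (\<integral>\<^sup>+x. norm (f x - s i x) \<partial>M) + (\<integral>\<^sup>+x. norm (f x - t i x) \<partial>M)) \<longlonglongrightarrow> ennreal 0"
      using tendsto_add[OF s0 t0] by simp
  qed
  then have "(\<lambda>i. norm (Bochner_Integration.simple_bochner_integral M (s i) - Bochner_Integration.simple_bochner_integral M (t i))) \<longlonglongrightarrow> 0"
    by (simp flip: ennreal_0)
  moreover have "(\<lambda>i. norm (Bochner_Integration.simple_bochner_integral M (s i) - Bochner_Integration.simple_bochner_integral M (t i)))
      \<longlonglongrightarrow> norm (I - J)"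
    by (intro tendsto_intros sI tJ)
  ultimately have "norm (I - J) = 0"
    using LIMSEQ_unique by blast
  then show ?thesis
    by simp
qed

lemma has_strong_bochner_integral_iff_library:
  fixes f :: "'a \<Rightarrow> 'b::{banach, second_countable_topology}"
  shows "has_strong_bochner_integral M f I \<longleftrightarrow> has_bochner_integral M f I"
proof
  assume "has_strong_bochner_integral M f I"
  then show "has_bochner_integral M f I"
    unfolding has_strong_bochner_integral_def by (auto intro: has_bochner_integral.intros)
next
  assume I: "has_bochner_integral M f I"
  then have f: "integrable M f" "integral\<^sup>L M f = I"
    by (auto simp: has_bochner_integral_iff)
  then have [measurable]: "f \<in> borel_measurable M" and fin: "(\<integral>\<^sup>+x. norm (f x) \<partial>M) < \<infinity>"
    by (auto simp: integrable_iff_bounded)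
  obtain s where "\<forall>i. simple_function M (s i)" "\<forall>x\<in>space M. (\<lambda>i. s i x) \<longlonglongrightarrow> f x"
    "\<forall>i. \<forall>x\<in>space M. dist (s i x) 0 \<le> 2 * dist (f x) 0"
    using borel_measurable_implies_sequence_metric[of f M 0] by auto
  then have s: "\<And>i. simple_function M (s i)"
    and lim: "\<And>x. x \<in> space M \<Longrightarrow> (\<lambda>i. s i x) \<longlonglongrightarrow> f x"
    and bd: "\<And>i x. x \<in> space M \<Longrightarrow> norm (s i x) \<le> 2 * norm (f x)"
    by (auto simp: dist_norm)
  have sm[measurable]: "s i \<in> borel_measurable M" for i
    using s by (rule borel_measurable_simple_function)
  have fin2: "(\<integral>\<^sup>+x. ennreal (2 * norm (f x)) \<partial>M) < \<infinity>"
    using fin by (simp add: nn_integral_cmult ennreal_mult ennreal_mult_less_top)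
  have sb: "Bochner_Integration.simple_bochner_integrable M (s i)" for i
  proof (rule simple_bochner_integrableI_bounded[OF s])
    have "(\<integral>\<^sup>+x. norm (s i x) \<partial>M) \<le> (\<integral>\<^sup>+x. ennreal (2 * norm (f x)) \<partial>M)"
      by (intro nn_integral_mono ennreal_leI bd)
    then show "(\<integral>\<^sup>+x. norm (s i x) \<partial>M) < \<infinity>"
      using fin2 by (rule order.strict_trans1)
  qed
  have conv: "(\<lambda>i. \<integral>\<^sup>+x. norm (f x - s i x) \<partial>M) \<longlonglongrightarrow> 0"
    by (rule nn_integral_dominated_convergence_norm[where w = "\<lambda>x. 2 * norm (f x)"])
      (use bd lim fin2 in auto)
  have "has_bochner_integral M (s i) (Bochner_Integration.simple_bochner_integral M (s i))" for i
    using sb by (rule has_bochner_integral_simple_bochner_integrable)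
  then have si: "integrable M (s i)" "integral\<^sup>L M (s i) = Bochner_Integration.simple_bochner_integral M (s i)" for i
    by (auto simp: has_bochner_integral_iff)
  have "(\<lambda>i. integral\<^sup>L M (s i)) \<longlonglongrightarrow> integral\<^sup>L M f"
    by (rule tendsto_L1_int) (use f si conv in \<open>simp_all add: norm_minus_commute\<close>)
  then have "(\<lambda>i. Bochner_Integration.simple_bochner_integral M (s i)) \<longlonglongrightarrow> I"
    using f si by simp
  then show "has_strong_bochner_integral M f I"
    unfolding has_strong_bochner_integral_def using sb lim conv by auto
qed

end

theory Submission
  imports Defs
begin

text \<open>
  Write \<open>I\<close>, \<open>N\<close> and \<open>K\<close> for the integrals of \<open>f\<close>, of \<open>norm \<circ> f\<close> and of \<open>k\<close>, and consider the real
  functional \<open>\<phi> x = Re \<langle>x, e\<rangle>\<close>. It is bounded, so it commutes with the Bochner integral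
  (\<open>has_strong_bochner_integral_bounded_linear\<close>), and integrating the hypothesis gives
  \<open>N - \<phi> I \<le> K\<close>. Since \<open>e\<close> is a unit vector, \<open>\<phi> I \<le> norm I\<close> by Cauchy-Schwarz, whence the upper
  bound \<open>N - norm I \<le> K\<close>; the lower bound is the triangle inequality for the Bochner integral.

  If the upper bound is attained, then \<open>N - K = norm I \<le> \<phi> I \<le> norm I\<close>, so Cauchy-Schwarz is an
  equality. In an inner product space this forces \<open>I = norm I *\<^sub>R e\<close>
  (\<open>eq_norm_scaleR_unit\<close>), which is the stated condition because \<open>norm I = N - K\<close>. Conversely,
  the stated condition gives \<open>norm I = \<bar>N - K\<bar> = N - K\<close>.
\<close>

section \<open>The real part of the inner product\<close>

lemma to_complex_one: "to_complex (1 :: 'k::real_or_complex) = 1"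
proof -
  have "to_complex (1 :: 'k) * to_complex (1 :: 'k) = to_complex (1 :: 'k)"
    by (simp flip: to_complex_mult)
  moreover have "to_complex (1 :: 'k) \<noteq> 0"
    using norm_to_complex[of "1 :: 'k"] by auto
  ultimately show ?thesis
    by simp
qed

lemma to_complex_of_real: "to_complex (of_real r :: 'k::real_or_complex) = of_real r"
  using to_complex_scaleR[of r "1 :: 'k"]
  by (simp add: of_real_def to_complex_one)

context hilbert_space
begin

definition re_ip :: "'h \<Rightarrow> 'h \<Rightarrow> real" where
  "re_ip x y = Re (to_complex (ip x y))"

lemma re_ip_add_left: "re_ip (x + y) z = re_ip x z + re_ip y z"
  by (simp add: re_ip_def ip_add_left to_complex_add)

lemma re_ip_scaleR_left: "re_ip (r *\<^sub>R x) y = r * re_ip x y"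
  by (simp add: re_ip_def ip_scale_left to_complex_mult to_complex_of_real flip: scale_of_real)

lemma re_ip_commute: "re_ip y x = re_ip x y"
  by (simp add: re_ip_def ip_commute[of y x])

lemma re_ip_self: "re_ip x x = (norm x)\<^sup>2"
  by (simp only: re_ip_def ip_self to_complex_of_real Re_complex_of_real)

lemma norm_diff_scaleR_unit:
  assumes "norm e = 1"
  shows "(norm (x - r *\<^sub>R e))\<^sup>2 = (norm x)\<^sup>2 - 2 * r * re_ip x e + r\<^sup>2"
proof -
  have add: "re_ip z (x + y) = re_ip z x + re_ip z y"
    and scaleR: "re_ip z (s *\<^sub>R x) = s * re_ip z x" for x y z s
    by (metis re_ip_commute re_ip_add_left, metis re_ip_commute re_ip_scaleR_left)
  have "(norm (x - r *\<^sub>R e))\<^sup>2 = re_ip (x + (- r) *\<^sub>R e) (x + (- r) *\<^sub>R e)"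
    by (simp add: re_ip_self)
  also have "\<dots> = re_ip x x - 2 * r * re_ip x e + r\<^sup>2 * re_ip e e"
    unfolding re_ip_add_left add re_ip_scaleR_left scaleR re_ip_commute[of e x]
    by (simp add: algebra_simps power2_eq_square)
  finally show ?thesis
    using assms by (simp add: re_ip_self)
qed

text \<open>
  This is Cauchy-Schwarz: the squared distance from \<open>x\<close> to its projection onto the real line
  spanned by \<open>e\<close> is \<open>(norm x)\<^sup>2 - (re_ip x e)\<^sup>2\<close>.
\<close>

lemma abs_re_ip_unit_le:
  assumes "norm e = 1"
  shows "\<bar>re_ip x e\<bar> \<le> norm x"
proof -
  have "0 \<le> (norm x)\<^sup>2 - (re_ip x e)\<^sup>2"
    using zero_le_power2[of "norm (x - re_ip x e *\<^sub>R e)"]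
    unfolding norm_diff_scaleR_unit[OF assms] by (simp add: power2_eq_square)
  then show ?thesis
    using abs_le_square_iff[of "re_ip x e" "norm x"] by simp
qed

lemma bounded_linear_re_ip_unit:
  assumes "norm e = 1"
  shows "bounded_linear (\<lambda>x. re_ip x e)"
  using abs_re_ip_unit_le[OF assms]
  by (intro bounded_linear_intro[where K = 1]) (auto simp: re_ip_add_left re_ip_scaleR_left)

text \<open>
  The equality case of Cauchy-Schwarz: the squared distance from \<open>x\<close> to \<open>norm x *\<^sub>R e\<close> is
  \<open>2 * norm x * (norm x - re_ip x e)\<close>, which is not positive here.
\<close>

lemma eq_norm_scaleR_unit:
  assumes "norm e = 1" and "norm x \<le> re_ip x e"
  shows "x = norm x *\<^sub>R e"
proof -
  have "(norm (x - norm x *\<^sub>R e))\<^sup>2 = 2 * norm x * (norm x - re_ip x e)"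
    unfolding norm_diff_scaleR_unit[OF assms(1)] by (simp add: algebra_simps power2_eq_square)
  also have "\<dots> \<le> 0"
    using assms(2) by (simp add: mult_nonneg_nonpos)
  finally show ?thesis
    by simp
qed

end


section \<open>Linear images and norms under the Bochner integral\<close>

text \<open>
  Composing the simple approximations of \<open>f\<close> with \<open>T\<close> keeps them simple, scales the mean error
  by at most a bound for \<open>T\<close>, and by linearity applies \<open>T\<close> to their integrals.
\<close>

lemma has_strong_bochner_integral_bounded_linear:
  fixes T :: "'b::real_normed_vector \<Rightarrow> 'c::real_normed_vector"
  assumes T: "bounded_linear T" and f: "has_strong_bochner_integral M f I"
  shows "has_strong_bochner_integral M (\<lambda>x. T (f x)) (T I)"
proof -
  interpret T: bounded_linear T by (rule T)
  obtain s where fm: "f \<in> borel_measurable M"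
    and s: "\<And>i. Bochner_Integration.simple_bochner_integrable M (s i)"
    and lim: "AE x in M. (\<lambda>i. s i x) \<longlonglongrightarrow> f x"
    and s0: "(\<lambda>i. \<integral>\<^sup>+x. norm (f x - s i x) \<partial>M) \<longlonglongrightarrow> 0"
    and sI: "(\<lambda>i. Bochner_Integration.simple_bochner_integral M (s i)) \<longlonglongrightarrow> I"
    using f unfolding has_strong_bochner_integral_def by blast
  obtain C where C: "0 \<le> C" "\<And>x. norm (T x) \<le> norm x * C"
    using T.nonneg_bounded by blast
  have Tf: "(\<lambda>x. T (f x)) \<in> borel_measurable M"
    by (rule measurable_compose[OF fm])
      (intro borel_measurable_continuous_onI T.continuous_on continuous_intros)
  have Ts: "Bochner_Integration.simple_bochner_integrable M (\<lambda>x. T (s i x))" for i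
    using simple_bochner_integrable_compose2[of "\<lambda>x y. T x", OF T.zero s s] .
  have bound: "(\<integral>\<^sup>+x. norm (T (f x) - T (s i x)) \<partial>M)
      \<le> ennreal C * (\<integral>\<^sup>+x. norm (f x - s i x) \<partial>M)" for i
  proof -
    have "(\<integral>\<^sup>+x. norm (T (f x) - T (s i x)) \<partial>M)
        \<le> (\<integral>\<^sup>+x. ennreal C * ennreal (norm (f x - s i x)) \<partial>M)"
      using C by (intro nn_integral_mono)
        (auto simp: mult.commute simp flip: T.diff ennreal_mult intro!: ennreal_leI)
    also have "\<dots> = ennreal C * (\<integral>\<^sup>+x. norm (f x - s i x) \<partial>M)"
      using borel_measurable_norm_diff_simple[OF fm, of "s i"] s[of i]
      by (intro nn_integral_cmult) (auto simp: simple_bochner_integrable.simps)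
    finally show ?thesis .
  qed
  have "(\<lambda>i. ennreal C * (\<integral>\<^sup>+x. norm (f x - s i x) \<partial>M)) \<longlonglongrightarrow> 0"
    using ennreal_tendsto_cmult[OF _ s0, of "ennreal C"] by simp
  from tendsto_sandwich[OF _ _ tendsto_const this]
  have Ts0: "(\<lambda>i. \<integral>\<^sup>+x. norm (T (f x) - T (s i x)) \<partial>M) \<longlonglongrightarrow> 0"
    using bound by simp
  have "(\<lambda>i. Bochner_Integration.simple_bochner_integral M (\<lambda>x. T (s i x))) \<longlonglongrightarrow> T I"
    using T.tendsto[OF sI] simple_bochner_integral_linear[OF T.linear_axioms s]
    by simp
  moreover have "AE x in M. (\<lambda>i. T (s i x)) \<longlonglongrightarrow> T (f x)"
    using lim by eventually_elim (rule T.tendsto)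
  ultimately show ?thesis
    unfolding has_strong_bochner_integral_def using Tf Ts Ts0
    by (intro conjI exI[of _ "\<lambda>i x. T (s i x)"]) auto
qed

text \<open>
  The norm is Lipschitz, so the norms of simple functions approximating \<open>f\<close> in mean approximate
  \<open>norm \<circ> f\<close> in mean. Hence \<open>norm \<circ> f\<close> is at finite distance from an integrable function, and
  the triangle inequality for simple functions passes to the limit.
\<close>

lemma has_strong_bochner_integral_norm:
  fixes f :: "'a \<Rightarrow> 'b::real_normed_vector"
  assumes f: "has_strong_bochner_integral M f I"
  shows "integrable M (\<lambda>x. norm (f x))" and "norm I \<le> (\<integral>x. norm (f x) \<partial>M)"
proof -
  obtain s where fm[measurable]: "f \<in> borel_measurable M"
    and s: "\<And>i. Bochner_Integration.simple_bochner_integrable M (s i)"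
    and s0: "(\<lambda>i. \<integral>\<^sup>+x. norm (f x - s i x) \<partial>M) \<longlonglongrightarrow> 0"
    and sI: "(\<lambda>i. Bochner_Integration.simple_bochner_integral M (s i)) \<longlonglongrightarrow> I"
    using f unfolding has_strong_bochner_integral_def by blast
  have nf[measurable]: "(\<lambda>x. norm (f x)) \<in> borel_measurable M"
    by (rule measurable_compose[OF fm])
      (intro borel_measurable_continuous_onI continuous_intros)
  have ns: "Bochner_Integration.simple_bochner_integrable M (\<lambda>x. norm (s i x))" for i
    using simple_bochner_integrable_compose2[of "\<lambda>x y. norm x", OF norm_zero s s] .
  have hs: "has_bochner_integral M (\<lambda>x. norm (s i x))
      (Bochner_Integration.simple_bochner_integral M (\<lambda>x. norm (s i x)))" for i
    by (rule has_bochner_integral_simple_bochner_integrable[OF ns])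
  then have si: "integrable M (\<lambda>x. norm (s i x))"
    and sint: "(\<integral>x. norm (s i x) \<partial>M)
      = Bochner_Integration.simple_bochner_integral M (\<lambda>x. norm (s i x))" for i
    by (auto simp: has_bochner_integral_iff)
  have lip: "(\<integral>\<^sup>+x. ennreal \<bar>norm (s i x) - norm (f x)\<bar> \<partial>M) \<le> (\<integral>\<^sup>+x. norm (f x - s i x) \<partial>M)" for i
    by (intro nn_integral_mono ennreal_leI) (metis norm_minus_commute norm_triangle_ineq3)
  from tendsto_sandwich[OF _ _ tendsto_const s0]
  have L1: "(\<lambda>i. \<integral>\<^sup>+x. ennreal \<bar>norm (s i x) - norm (f x)\<bar> \<partial>M) \<longlonglongrightarrow> 0"
    using lip by simp
  show int: "integrable M (\<lambda>x. norm (f x))"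
  proof -
    obtain i where "(\<integral>\<^sup>+x. ennreal \<bar>norm (s i x) - norm (f x)\<bar> \<partial>M) < 1"
      using order_tendstoD(2)[OF L1, of 1] by (auto simp: eventually_sequentially)
    then have "(\<integral>\<^sup>+x. ennreal (norm (norm (s i x) - norm (f x))) \<partial>M) < \<infinity>"
      by (simp add: order.strict_trans[OF _ ennreal_one_less_top])
    then have "integrable M (\<lambda>x. norm (s i x) - norm (f x))"
      using borel_measurable_integrable[OF si[of i]] nf
      by (intro integrableI_bounded borel_measurable_diff)
    from Bochner_Integration.integrable_diff[OF si[of i] this] show ?thesis
      by simp
  qed
  have "(\<lambda>i. \<integral>x. norm (s i x) \<partial>M) \<longlonglongrightarrow> (\<integral>x. norm (f x) \<partial>M)"
    by (rule tendsto_L1_int) (use int si L1 in auto)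
  then show "norm I \<le> (\<integral>x. norm (f x) \<partial>M)"
    using simple_bochner_integral_norm_bound[OF s]
    by (intro LIMSEQ_le[OF tendsto_norm[OF sI]]) (auto simp: sint)
qed

lemma has_strong_bochner_integral_strong_bochner_integral:
  assumes "strong_bochner_integrable M f"
  shows "has_strong_bochner_integral M f (strong_bochner_integral M f)"
proof -
  obtain I where I: "has_strong_bochner_integral M f I"
    using assms by (auto simp: strong_bochner_integrable_def)
  then have "(THE J. has_strong_bochner_integral M f J) = I"
    using has_strong_bochner_integral_unique by blast
  then show ?thesis
    using assms I by (simp add: strong_bochner_integral_def)
qed


section \<open>The reverse triangle inequality\<close>

theorem theorem2:
  fixes a b :: real
    and scale :: "'k::real_or_complex \<Rightarrow> 'h::banach \<Rightarrow> 'h"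
    and ip :: "'h \<Rightarrow> 'h \<Rightarrow> 'k"
    and f :: "real \<Rightarrow> 'h" and e :: 'h and k :: "real \<Rightarrow> real"
  assumes "hilbert_space scale ip"
    and "a < b"
    and "strong_bochner_integrable (lebesgue_on {a..b}) f"
    and "norm e = 1"
    and "\<forall>t\<in>{a..b}. 0 \<le> k t"
    and "integrable (lebesgue_on {a..b}) k"
    and "AE t in lebesgue_on {a..b}. norm (f t) - Re (to_complex (ip (f t) e)) \<le> k t"
  shows "0 \<le> (LINT t|lebesgue_on {a..b}. norm (f t))
             - norm (strong_bochner_integral (lebesgue_on {a..b}) f) \<and>
         (LINT t|lebesgue_on {a..b}. norm (f t))
             - norm (strong_bochner_integral (lebesgue_on {a..b}) f)
           \<le> (LINT t|lebesgue_on {a..b}. k t) \<and>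
         ((LINT t|lebesgue_on {a..b}. norm (f t))
             - norm (strong_bochner_integral (lebesgue_on {a..b}) f)
           = (LINT t|lebesgue_on {a..b}. k t)
          \<longleftrightarrow>
          (LINT t|lebesgue_on {a..b}. norm (f t)) \<ge> (LINT t|lebesgue_on {a..b}. k t) \<and>
          strong_bochner_integral (lebesgue_on {a..b}) f
            = ((LINT t|lebesgue_on {a..b}. norm (f t)) - (LINT t|lebesgue_on {a..b}. k t)) *\<^sub>R e)"
proof -
  interpret hilbert_space scale ip by (rule assms(1))
  define M where "M = lebesgue_on {a..b}"
  define I where "I = strong_bochner_integral M f"
  define N where "N = (LINT t|M. norm (f t))"
  define K where "K = (LINT t|M. k t)"
  have f: "has_strong_bochner_integral M f I"
    unfolding I_def M_def
    by (rule has_strong_bochner_integral_strong_bochner_integral[OF assms(3)])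
  note e = \<open>norm e = 1\<close>
  have "has_bochner_integral M (\<lambda>t. re_ip (f t) e) (re_ip I e)"
    using has_strong_bochner_integral_bounded_linear[OF bounded_linear_re_ip_unit[OF e] f]
    by (simp add: has_strong_bochner_integral_iff_library)
  then have re: "integrable M (\<lambda>t. re_ip (f t) e)" "(LINT t|M. re_ip (f t) e) = re_ip I e"
    by (auto simp: has_bochner_integral_iff)
  have int: "integrable M (\<lambda>t. norm (f t))" and lower: "norm I \<le> N"
    using has_strong_bochner_integral_norm[OF f] by (auto simp: N_def)
  have "integrable M k" and "AE t in M. norm (f t) - re_ip (f t) e \<le> k t"
    unfolding M_def re_ip_def by (fact assms(6), fact assms(7))
  then have "(LINT t|M. norm (f t) - re_ip (f t) e) \<le> K"
    unfolding K_def
    by (intro integral_mono_AE Bochner_Integration.integrable_diff int re(1))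
  then have main: "N - re_ip I e \<le> K"
    using int re by (simp add: N_def)
  have cs: "re_ip I e \<le> norm I"
    using abs_re_ip_unit_le[OF e, of I] by simp
  have "N - norm I = K \<longleftrightarrow> K \<le> N \<and> I = (N - K) *\<^sub>R e"
  proof
    assume eq: "N - norm I = K"
    then have NK: "N - K = norm I"
      by simp
    have "norm I \<le> re_ip I e"
      using eq main by simp
    from eq_norm_scaleR_unit[OF e this] have "I = (N - K) *\<^sub>R e"
      unfolding NK .
    then show "K \<le> N \<and> I = (N - K) *\<^sub>R e"
      using NK norm_ge_zero[of I] by linarith
  next
    assume R: "K \<le> N \<and> I = (N - K) *\<^sub>R e"
    then have "norm I = N - K"
      using e by simp
    then show "N - norm I = K"
      by simp
  qed
  moreover have "0 \<le> N - norm I" and "N - norm I \<le> K"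
    using lower main cs by linarith+
  ultimately show ?thesis
    unfolding N_def K_def I_def M_def by blast
qed

end
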